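(* Let $0<\epsilon<\frac12$ and $f:\mathcal X\times\mathcal Y\to\{0,1\}^k$. Let $R=R^{\mathrm{xor},\mathrm{priv}}_\epsilon(f)$ and $M=16\left(\frac12-\epsilon\right)^{-2}2^{R}$. Then $$D^{\mathrm{xor}}(f)\le 2^{R+1}\left(R+\log\left(\frac{8}{\frac12-\epsilon}\right)+1\right)+k\left(\frac{5-2\epsilon}{4}M+1\right).$$
   Context: Two-party communication: Alice receives $x\in\mathcal X$, Bob receives $y\in\mathcal Y$; players may use private randomness ($r_A$ for Alice, $r_B$ for Bob) and public randomness $r$; the transcript $t_\pi$ is the sequence of exchanged bits (public randomness excluded) and the cost is the maximum number of bits exchanged. A protocol XOR-computes $f$ with error $\epsilon$ if there are maps $O_A(t_\pi,r,r_A,x)\in\{0,1\}^k$, $O_B(t_\pi,r,r_B,y)\in\{0,1\}^k$ with $\Pr[O_A\oplus O_B=f(x,y)]\ge1-\epsilon$ for every $(x,y)$ ($\oplus$ bitwise XOR). $R^{\mathrm{xor},\mathrm{priv}}_\epsilon(f)$ is the minimum cost of such a protocol using private coins only; $D^{\mathrm{xor}}(f)$ is the minimum cost of a deterministic protocol XOR-computing $f$ with zero error. Logarithms are base 2. *)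

theory Defs
  imports "HOL-Probability.Probability"
begin

text \<open>
  A communication protocol is a finite binary tree whose inner nodes are owned by one of the two
  players, who sends there one bit computed from his or her own \<open>view\<close> (type \<open>'a\<close> for Alice,
  \<open>'b\<close> for Bob). The first subtree is entered after the bit \<^const>\<open>False\<close>, the second one
  after \<^const>\<open>True\<close>. The view is the input alone in a deterministic protocol, and the pair of
  private coins and input in a private-coin protocol; dependence of a message on the bits sent
  before is expressed by its position in the tree.
\<close>

datatype ('a, 'b) protocol =
    Stop
  | Alice "'a \<Rightarrow> bool" "('a, 'b) protocol" "('a, 'b) protocol"
  | Bob "'b \<Rightarrow> bool" "('a, 'b) protocol" "('a, 'b) protocol"

fun transcript :: "('a, 'b) protocol \<Rightarrow> 'a \<Rightarrow> 'b \<Rightarrow> bool list" where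
  "transcript Stop a b = []"
| "transcript (Alice m p0 p1) a b = m a # transcript (if m a then p1 else p0) a b"
| "transcript (Bob m p0 p1) a b = m b # transcript (if m b then p1 else p0) a b"

text \<open>The set below is nonempty and bounded by the height of the tree, so \<^const>\<open>Max\<close> is
  meaningful even when there are infinitely many views.\<close>

definition cost :: "('a, 'b) protocol \<Rightarrow> nat" where
  "cost \<pi> = Max {length (transcript \<pi> a b) | a b. True}"

definition bit_strings :: "nat \<Rightarrow> bool list set" where
  "bit_strings k = {s. length s = k}"

definition bxor :: "bool list \<Rightarrow> bool list \<Rightarrow> bool list" where
  "bxor = map2 (\<noteq>)"

definition xor_computes_det ::
    "nat \<Rightarrow> ('x \<Rightarrow> 'y \<Rightarrow> bool list) \<Rightarrow> ('x, 'y) protocol \<Rightarrow> bool" where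
  "xor_computes_det k f \<pi> \<longleftrightarrow>
     (\<exists>(O\<^sub>A :: bool list \<Rightarrow> 'x \<Rightarrow> bool list) (O\<^sub>B :: bool list \<Rightarrow> 'y \<Rightarrow> bool list).
        (\<forall>t x. O\<^sub>A t x \<in> bit_strings k) \<and>
        (\<forall>t y. O\<^sub>B t y \<in> bit_strings k) \<and>
        (\<forall>x y. bxor (O\<^sub>A (transcript \<pi> x y) x) (O\<^sub>B (transcript \<pi> x y) y) = f x y))"

text \<open>
  The private coins are random strings, drawn independently by the two players from arbitrary
  discrete distributions that do not depend on the inputs. This loses no generality compared with
  arbitrary probability spaces: every real number in \<open>[0, 1]\<close> is the probability of an event under
  the distribution with weights \<open>1/2, 1/4, 1/8, \<dots>\<close>, so a player can resample every message and
  the output, conditioned on the transcript so far, from finitely many discrete draws.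
\<close>

type_synonym coins = "bool list"

definition xor_computes_priv ::
    "nat \<Rightarrow> real \<Rightarrow> ('x \<Rightarrow> 'y \<Rightarrow> bool list) \<Rightarrow> (coins \<times> 'x, coins \<times> 'y) protocol \<Rightarrow> bool" where
  "xor_computes_priv k \<epsilon> f \<pi> \<longleftrightarrow>
     (\<exists>(\<mu>\<^sub>A :: coins pmf) (\<mu>\<^sub>B :: coins pmf)
       (O\<^sub>A :: bool list \<Rightarrow> coins \<Rightarrow> 'x \<Rightarrow> bool list) (O\<^sub>B :: bool list \<Rightarrow> coins \<Rightarrow> 'y \<Rightarrow> bool list).
        (\<forall>t r x. O\<^sub>A t r x \<in> bit_strings k) \<and>
        (\<forall>t r y. O\<^sub>B t r y \<in> bit_strings k) \<and>
        (\<forall>x y. measure_pmf.prob (pair_pmf \<mu>\<^sub>A \<mu>\<^sub>B)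
                 {(r\<^sub>A, r\<^sub>B).
                    bxor (O\<^sub>A (transcript \<pi> (r\<^sub>A, x) (r\<^sub>B, y)) r\<^sub>A x)
                         (O\<^sub>B (transcript \<pi> (r\<^sub>A, x) (r\<^sub>B, y)) r\<^sub>B y) = f x y}
               \<ge> 1 - \<epsilon>))"

text \<open>Infima in \<^typ>\<open>enat\<close> are minima when the set is nonempty; the value is \<open>\<infinity>\<close> if no
  protocol exists, which can only happen for infinite input types (see \<open>R_xor_priv_finite\<close>).\<close>

definition D_xor :: "nat \<Rightarrow> ('x \<Rightarrow> 'y \<Rightarrow> bool list) \<Rightarrow> enat" where
  "D_xor k f = (INF \<pi> \<in> {\<pi>. xor_computes_det k f \<pi>}. enat (cost \<pi>))"

definition R_xor_priv :: "nat \<Rightarrow> real \<Rightarrow> ('x \<Rightarrow> 'y \<Rightarrow> bool list) \<Rightarrow> enat" where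
  "R_xor_priv k \<epsilon> f = (INF \<pi> \<in> {\<pi>. xor_computes_priv k \<epsilon> f \<pi>}. enat (cost \<pi>))"

lemma R_xor_priv_finite:
  fixes f :: "'x::finite \<Rightarrow> 'y \<Rightarrow> bool list"
  assumes "0 \<le> \<epsilon>" and f: "\<And>x y. f x y \<in> bit_strings k"
  shows "R_xor_priv k \<epsilon> f \<noteq> \<infinity>"
proof -
  have "\<exists>\<pi> :: (coins \<times> 'x, coins \<times> 'y) protocol. \<exists>g.
          \<forall>x\<in>A. \<forall>r s y. g (transcript \<pi> (r, x) (s, y)) = x" if "finite A" for A :: "'x set"
    using that
  proof induction
    case empty
    then show ?case by simp
  next
    case (insert z A)
    then obtain \<pi> :: "(coins \<times> 'x, coins \<times> 'y) protocol" and g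
      where g: "\<forall>x\<in>A. \<forall>r s y. g (transcript \<pi> (r, x) (s, y)) = x" by blast
    show ?case
      by (rule exI[of _ "Alice (\<lambda>v. snd v = z) \<pi> Stop"],
          rule exI[of _ "\<lambda>t. if hd t then z else g (tl t)"]) (use g in auto)
  qed
  from this[of UNIV] obtain \<pi> :: "(coins \<times> 'x, coins \<times> 'y) protocol" and g
    where g: "\<And>x r s y. g (transcript \<pi> (r, x) (s, y)) = x" by auto
  have bx: "bxor (replicate (length u) False) u = u" for u
    by (induction u) (auto simp: bxor_def)
  have len: "length (f x y) = k" for x y
    using f by (simp add: bit_strings_def)
  have bx': "bxor (replicate k False) (f x y) = f x y" for x y
    using bx[of "f x y"] by (simp add: len)
  have "xor_computes_priv k \<epsilon> f \<pi>"
    unfolding xor_computes_priv_def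
    by (rule exI[of _ "return_pmf []"], rule exI[of _ "return_pmf []"],
        rule exI[of _ "\<lambda>t r x. replicate k False"], rule exI[of _ "\<lambda>t r y. f (g t) y"])
       (use assms in \<open>auto simp: g bx' len bit_strings_def indicator_def\<close>)
  then have "R_xor_priv k \<epsilon> f \<le> enat (cost \<pi>)"
    unfolding R_xor_priv_def by (intro INF_lower) simp
  then show ?thesis by (metis enat_ord_simps(5) infinity_ne_i0 enat.distinct(1))
qed

end

theory Submission
  imports Defs
begin

text \<open>
  For a transcript \<open>t\<close>, the probability that \<open>t\<close> occurs and the players output \<open>u\<close> and \<open>v\<close> is a
  product \<open>P t x u * Q t y v\<close>, since the coins consistent with \<open>t\<close> form a rectangle. Bob sends
  upper approximations \<open>bh t\<close> of \<open>\<beta> t y = (\<Sum>v. Q t y v)\<close>, at most \<open>1 / 2 ^ R\<close> above. Alice then rounds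
  \<open>P t x u\<close> down to a multiple \<open>w (t, u) * c / bh t\<close> with \<open>c = \<delta> / 2 ^ R\<close>, \<open>\<delta> = 1/2 - \<epsilon>\<close>, and sends the
  counts \<open>w\<close>. As \<open>\<beta> t y \<le> bh t\<close>, each transcript contributes an error of at most \<open>c\<close>, so Bob knows
  the probability that the outputs XOR to \<open>z\<close> up to a one-sided error of \<open>\<delta>\<close>, and \<open>f x y\<close> is the
  only \<open>z\<close> with estimate at least \<open>1/2\<close>. The counts sum to at most
  \<open>(\<Sum>t u. P t x u * bh t) / c \<le> 2 * 2 ^ R / \<delta>\<close>, so there are few possible tables \<open>w\<close>.
\<close>

section \<open>Transcripts of protocol trees\<close>

text \<open>At a node of Alice the bit depends on \<open>a\<close> alone and agrees with the run on
  \<open>b'\<close>; at a node of Bob it agrees with the run on \<open>a'\<close>.\<close>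

lemma transcript_rectangle:
  "transcript \<pi> a b' = t \<Longrightarrow> transcript \<pi> a' b = t \<Longrightarrow> transcript \<pi> a b = t"
  by (induction \<pi> arbitrary: t) (auto split: if_splits)

text \<open>Transcripts label the leaves of a binary tree, and no leaf lies below another.\<close>

lemma transcript_prefix_free:
  "transcript \<pi> a' b' = transcript \<pi> a b @ s \<Longrightarrow> s = []"
  by (induction \<pi>) (auto split: if_splits)

lemma ex_transcript_length_bound: "\<exists>h. \<forall>a b. length (transcript \<pi> a b) \<le> h"
proof (induction \<pi>)
  case (Alice m p q)
  then obtain h h' where "\<forall>a b. length (transcript p a b) \<le> h"
      "\<forall>a b. length (transcript q a b) \<le> h'" by blast
  then show ?case by (intro exI[of _ "Suc (max h h')"]) (auto simp: le_max_iff_disj)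
next
  case (Bob m p q)
  then obtain h h' where "\<forall>a b. length (transcript p a b) \<le> h"
      "\<forall>a b. length (transcript q a b) \<le> h'" by blast
  then show ?case by (intro exI[of _ "Suc (max h h')"]) (auto simp: le_max_iff_disj)
qed auto

lemma length_transcript_le_cost: "length (transcript \<pi> a b) \<le> cost \<pi>"
proof -
  obtain h where "\<forall>a b. length (transcript \<pi> a b) \<le> h"
    using ex_transcript_length_bound by blast
  then have "finite {length (transcript \<pi> a b) | a b. True}"
    by (auto intro: finite_subset[of _ "{..h}"])
  then show ?thesis unfolding cost_def by (intro Max_ge) auto
qed

lemma cost_le:
  assumes "\<And>a b. length (transcript \<pi> a b) \<le> n"
  shows "cost \<pi> \<le> n"
proof -
  have "finite {length (transcript \<pi> a b) | a b. True}"
    by (rule finite_subset[of _ "{..n}"]) (use assms in auto)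
  then show ?thesis unfolding cost_def using assms by (subst Max_le_iff) auto
qed

lemma finite_bit_strings: "finite (bit_strings n)"
  and card_bit_strings: "card (bit_strings n) = 2 ^ n"
  using finite_lists_length_eq[of "UNIV :: bool set" n] card_lists_length_eq[of "UNIV :: bool set" n]
  by (auto simp: bit_strings_def)

text \<open>Padding with \<open>False\<close> to length \<open>cost \<pi>\<close> is injective: if
  two padded transcripts agree, one transcript is a prefix of the other, hence equal to it.\<close>

lemma finite_transcripts: "finite {transcript \<pi> a b | a b. True}"
  and card_transcripts_le: "card {transcript \<pi> a b | a b. True} \<le> 2 ^ cost \<pi>"
proof -
  let ?T = "{transcript \<pi> a b | a b. True}" and ?pad = "\<lambda>t. t @ replicate (cost \<pi> - length t) False"
  have "t = t'" if "t \<in> ?T" "t' \<in> ?T" "?pad t = ?pad t'" for t t'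
  proof -
    have "\<exists>s. t' = t @ s \<or> t = t' @ s"
      using that(3) by (auto simp: append_eq_append_conv2)
    then show ?thesis using that(1,2) by (auto dest: transcript_prefix_free)
  qed
  then have inj: "inj_on ?pad ?T" by (auto intro!: inj_onI)
  have sub: "?pad ` ?T \<subseteq> bit_strings (cost \<pi>)"
    using length_transcript_le_cost[of \<pi>] by (auto simp: bit_strings_def)
  show "finite ?T" by (rule inj_on_finite[OF inj sub finite_bit_strings])
  show "card ?T \<le> 2 ^ cost \<pi>"
    using card_inj_on_le[OF inj sub finite_bit_strings] by (simp add: card_bit_strings)
qed

section \<open>Sending encoded messages\<close>

text \<open>Alice sends the first bit; the subtree below stores it in the continuation, so
  \<open>c\<close> can depend on the whole message.\<close>

lemma alice_sends:
  assumes "\<And>a. length (g a) = n"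
  shows "\<exists>\<pi>. \<forall>a b. transcript \<pi> a b = g a @ transcript (c (g a)) a b"
  using assms
proof (induction n arbitrary: g c)
  case 0
  then show ?case by (intro exI[of _ "c []"]) auto
next
  case (Suc n)
  have "\<exists>\<pi>. \<forall>a b. transcript \<pi> a b = tl (g a) @ transcript (c (v # tl (g a))) a b" for v
    by (rule Suc.IH[of "\<lambda>a. tl (g a)" "\<lambda>s. c (v # s)"]) (simp add: Suc.prems)
  then obtain p where p: "\<And>v a b. transcript (p v) a b = tl (g a) @ transcript (c (v # tl (g a))) a b"
    by metis
  have ne: "g a = hd (g a) # tl (g a)" for a using Suc.prems[of a] by (cases "g a") auto
  have "transcript (Alice (\<lambda>a. hd (g a)) (p False) (p True)) a b
      = g a @ transcript (c (g a)) a b" for a b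
    using ne[of a] by (cases "hd (g a)") (simp_all add: p flip: append_Cons)
  then show ?case by blast
qed

lemma bob_sends:
  assumes "\<And>b. length (g b) = n"
  shows "\<exists>\<pi>. \<forall>a b. transcript \<pi> a b = g b @ transcript (c (g b)) a b"
  using assms
proof (induction n arbitrary: g c)
  case 0
  then show ?case by (intro exI[of _ "c []"]) auto
next
  case (Suc n)
  have "\<exists>\<pi>. \<forall>a b. transcript \<pi> a b = tl (g b) @ transcript (c (v # tl (g b))) a b" for v
    by (rule Suc.IH[of "\<lambda>b. tl (g b)" "\<lambda>s. c (v # s)"]) (simp add: Suc.prems)
  then obtain p where p: "\<And>v a b. transcript (p v) a b = tl (g b) @ transcript (c (v # tl (g b))) a b"
    by metis
  have ne: "g b = hd (g b) # tl (g b)" for b using Suc.prems[of b] by (cases "g b") auto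
  have "transcript (Bob (\<lambda>b. hd (g b)) (p False) (p True)) a b
      = g b @ transcript (c (g b)) a b" for a b
    using ne[of b] by (cases "hd (g b)") (simp_all add: p flip: append_Cons)
  then show ?case by blast
qed

text \<open>Elements outside \<open>S\<close> also get length \<open>n\<close>, which provides the
  unconditional length assumption of \<open>alice_sends\<close> and
  \<open>bob_sends\<close>.\<close>

lemma ex_binary_code:
  assumes "finite S" "card S \<le> 2 ^ n"
  shows "\<exists>e. inj_on e S \<and> (\<forall>s. length (e s :: bool list) = n)"
proof -
  have "\<exists>e. e ` S \<subseteq> bit_strings n \<and> inj_on e S"
    using assms finite_bit_strings card_bit_strings by (intro card_le_inj) auto
  then obtain e where "e ` S \<subseteq> bit_strings n" "inj_on e S" by blast
  then show ?thesis
    by (intro exI[of _ "\<lambda>s. if s \<in> S then e s else replicate n False"])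
       (auto simp: bit_strings_def inj_on_def)
qed

section \<open>Algebra of bitwise XOR\<close>

lemma bxor_replicate_False: "length u = k \<Longrightarrow> bxor (replicate k False) u = u"
  by (auto simp: bxor_def intro!: nth_equalityI)

lemma bxor_in_bit_strings: "u \<in> bit_strings k \<Longrightarrow> v \<in> bit_strings k \<Longrightarrow> bxor u v \<in> bit_strings k"
  by (simp add: bit_strings_def bxor_def)

lemma bxor_cancel_left: "u \<in> bit_strings k \<Longrightarrow> v \<in> bit_strings k \<Longrightarrow> bxor u (bxor u v) = v"
  by (auto simp: bit_strings_def bxor_def intro!: nth_equalityI)

lemma bxor_commute: "u \<in> bit_strings k \<Longrightarrow> v \<in> bit_strings k \<Longrightarrow> bxor u v = bxor v u"
  by (auto simp: bit_strings_def bxor_def intro!: nth_equalityI)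

text \<open>XOR with \<open>z\<close> is an involution. Reindexing by it turns the sum of
  \<open>Q t y (bxor u z)\<close> over \<open>u\<close> into \<open>\<beta> t y\<close>.\<close>

lemma bij_betw_bxor:
  assumes "z \<in> bit_strings k"
  shows "bij_betw (\<lambda>u. bxor u z) (bit_strings k) (bit_strings k)"
proof (rule bij_betwI[where g = "\<lambda>u. bxor u z"])
  show "bxor (bxor u z) z = u" if "u \<in> bit_strings k" for u
    using assms that by (metis bxor_cancel_left bxor_commute bxor_in_bit_strings)
  then show "bxor (bxor u z) z = u" if "u \<in> bit_strings k" for u using that .
qed (use assms bxor_in_bit_strings in auto)

section \<open>Deterministic protocols with two messages\<close>

text \<open>Bob sends \<open>mB y\<close>, Alice replies with \<open>mA (mB y) x\<close>, and Bob
  alone computes the value; Alice outputs the zero string, which is neutral for XOR.\<close>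

lemma D_xor_le_two_messages:
  fixes f :: "'x \<Rightarrow> 'y \<Rightarrow> bool list"
  assumes f: "\<And>x y. f x y \<in> bit_strings k"
    and B: "finite B" "card B \<le> 2 ^ n" "\<And>y. mB y \<in> B"
    and A: "finite A" "card A \<le> 2 ^ m" "\<And>c x. mA c x \<in> A"
    and g: "\<And>x y. g (mB y) (mA (mB y) x) y = f x y"
  shows "D_xor k f \<le> enat (n + m)"
proof -
  obtain eB :: "_ \<Rightarrow> bool list" where eB: "inj_on eB B" "\<And>s. length (eB s) = n"
    using ex_binary_code[OF B(1,2)] by blast
  obtain eA :: "_ \<Rightarrow> bool list" where eA: "inj_on eA A" "\<And>s. length (eA s) = m"
    using ex_binary_code[OF A(1,2)] by blast
  define dB where "dB = inv_into B eB"
  define dA where "dA = inv_into A eA"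
  have dB: "dB (eB (mB y)) = mB y" for y by (simp add: dB_def eB(1) B(3))
  have dA: "dA (eA (mA (mB y) x)) = mA (mB y) x" for x y by (simp add: dA_def eA(1) A(3))
  have "\<exists>\<pi>. \<forall>x y. transcript \<pi> x y = eA (mA (dB s) x) @ transcript Stop x (y::'y)" for s
    by (rule alice_sends[of _ m]) (rule eA)
  then obtain p :: "bool list \<Rightarrow> ('x, 'y) protocol"
    where p: "\<And>s x y. transcript (p s) x y = eA (mA (dB s) x) @ []"
    unfolding transcript.simps by metis
  have "\<exists>\<pi>. \<forall>x y. transcript \<pi> x y = eB (mB y) @ transcript (p (eB (mB y))) x y"
    by (rule bob_sends[of _ n]) (rule eB)
  then obtain \<pi> where \<pi>: "\<And>x y. transcript \<pi> x y = eB (mB y) @ eA (mA (mB y) x)"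
    by (auto simp: p dB)
  \<comment> \<open>Strings that are not transcripts may decode to anything, so the output falls
    back to some \<open>k\<close>-bit string.\<close>
  define OB where "OB t y = (let z = g (dB (take n t)) (dA (drop n t)) y in
      if z \<in> bit_strings k then z else replicate k False)" for t y
  have "OB (transcript \<pi> x y) y = f x y" for x y
    by (simp add: OB_def \<pi> eB dB dA g f)
  moreover have "OB t y \<in> bit_strings k" for t y
    by (simp add: OB_def Let_def bit_strings_def)
  ultimately have "xor_computes_det k f \<pi>"
    unfolding xor_computes_det_def using f
    by (intro exI[of _ "\<lambda>t x. replicate k False"] exI[of _ OB])
       (auto simp: bit_strings_def bxor_replicate_False)
  then have "D_xor k f \<le> enat (cost \<pi>)"
    unfolding D_xor_def by (intro INF_lower) simp
  also have "cost \<pi> \<le> n + m" by (rule cost_le) (simp add: \<pi> eA eB)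
  finally show ?thesis by simp
qed

section \<open>Counting tables of bounded sum\<close>

text \<open>The functions correspond to the lists of their values, extended by the slack \<open>K - sum w S\<close>.\<close>

lemma card_bounded_sum_functions:
  fixes K :: nat
  assumes "finite S"
  defines "F \<equiv> {w \<in> extensional S. sum w S \<le> K}"
  shows "finite F" and "card F \<le> (card S + K) choose K"
proof -
  obtain xs where xs: "set xs = S" "distinct xs"
    using finite_distinct_list[OF assms(1)] by blast
  have len: "length xs = card S" using xs distinct_card by fastforce
  let ?L = "{l. length l = card S + 1 \<and> sum_list l = K}"
  let ?h = "\<lambda>w. map w xs @ [K - sum w S]"
  have inj: "inj_on ?h F"
  proof (rule inj_onI)
    fix w w' assume "w \<in> F" "w' \<in> F" "?h w = ?h w'"
    then show "w = w'" using xs(1) by (intro extensionalityI[of _ S]) (auto simp: F_def)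
  qed
  have sub: "?h ` F \<subseteq> ?L"
    using xs by (auto simp: F_def len sum_list_distinct_conv_sum_set)
  have "?L \<subseteq> {l. set l \<subseteq> {..K} \<and> length l = card S + 1}"
    by (auto intro: member_le_sum_list)
  then have fin: "finite ?L" by (rule finite_subset) (simp add: finite_lists_length_eq)
  show "finite F" by (rule inj_on_finite[OF inj sub fin])
  have "card F \<le> card ?L" by (rule card_inj_on_le[OF inj sub fin])
  also have "card ?L = (card S + K) choose K"
    by (subst card_length_sum_list) (simp add: add.commute)
  finally show "card F \<le> (card S + K) choose K" .
qed

text \<open>The \<open>K\<close>-th term of the binomial expansion of \<open>1 = (z + (1 - z)) ^ (m + K)\<close> is at most 1;
  take \<open>z = 1 / 2 ^ (k + 1)\<close>.\<close>

lemma binomial_le_power2: "(N * 2 ^ k + K) choose K \<le> 2 ^ ((k + 1) * K + N)"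
proof -
  define m :: nat where "m = N * 2 ^ k"
  define z :: real where "z = 1 / 2 ^ (k + 1)"
  have z: "0 < z" "z \<le> 1"
    using one_le_power[of "2::real" "k + 1"] by (auto simp: z_def)
  have "real ((m + K) choose K) * z ^ K * (1 - z) ^ (m + K - K)
      \<le> (\<Sum>j\<le>m + K. real ((m + K) choose j) * z ^ j * (1 - z) ^ (m + K - j))"
    by (rule member_le_sum) (use z in auto)
  also have "\<dots> = (z + (1 - z)) ^ (m + K)" by (rule binomial_ring[symmetric])
  finally have le1: "real ((m + K) choose K) * z ^ K * (1 - z) ^ m \<le> 1" by simp
  \<comment> \<open>For \<open>2 ^ k\<close> factors the Bernoulli bound is exactly
    \<open>1 / 2\<close>, so all \<open>N * 2 ^ k\<close> factors \<open>1 - z\<close> together cost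
    only \<open>2 ^ N\<close>.\<close>
  have "1 + real (2 ^ k) * (- z) \<le> (1 + - z) ^ (2 ^ k)"
    by (rule Bernoulli_inequality) (use z in simp)
  then have "1 / 2 \<le> (1 - z) ^ (2 ^ k)" by (simp add: z_def)
  then have "(1 / 2) ^ N \<le> ((1 - z) ^ (2 ^ k)) ^ N" by (rule power_mono) simp
  also have "\<dots> = (1 - z) ^ m" by (simp add: m_def mult.commute flip: power_mult)
  finally have "real ((m + K) choose K) * z ^ K * (1 / 2) ^ N \<le> real ((m + K) choose K) * z ^ K * (1 - z) ^ m"
    using z by (intro mult_left_mono) auto
  with le1 have "real ((m + K) choose K) * z ^ K * (1 / 2) ^ N \<le> 1" by linarith
  moreover have "z ^ K = 1 / 2 ^ ((k + 1) * K)" 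
    by (simp only: z_def power_one_over power_mult)
  ultimately have "real ((m + K) choose K) \<le> 2 ^ ((k + 1) * K) * 2 ^ N"
    by (simp add: power_one_over field_simps)
  then have "real ((m + K) choose K) \<le> real (2 ^ ((k + 1) * K + N))" by (simp add: power_add)
  then show ?thesis unfolding m_def of_nat_le_iff .
qed

section \<open>Product form of the law of transcript and outputs\<close>

text \<open>The coins are independent, so the joint law of transcript and outputs factors.
  \<open>P\<close> involves only Alice's data and \<open>Q\<close> only Bob's, so each player knows
  one factor without communication.\<close>

lemma xor_priv_product_form:
  fixes f :: "'x \<Rightarrow> 'y \<Rightarrow> bool list"
  assumes f: "\<And>x y. f x y \<in> bit_strings k"
    and "xor_computes_priv k \<epsilon> f \<pi>"
  obtains T :: "bool list set" and P :: "bool list \<Rightarrow> 'x \<Rightarrow> bool list \<Rightarrow> real"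
    and Q :: "bool list \<Rightarrow> 'y \<Rightarrow> bool list \<Rightarrow> real"
  where "finite T" and "card T \<le> 2 ^ cost \<pi>"
    and "\<And>t x u. P t x u \<ge> 0" and "\<And>t y v. Q t y v \<ge> 0"
    and "\<And>t x. (\<Sum>u\<in>bit_strings k. P t x u) \<le> 1"
    and "\<And>t y. (\<Sum>v\<in>bit_strings k. Q t y v) \<le> 1"
    and "\<And>x y. (\<Sum>t\<in>T. \<Sum>u\<in>bit_strings k. \<Sum>v\<in>bit_strings k. P t x u * Q t y v) = 1"
    and "\<And>x y. (\<Sum>t\<in>T. \<Sum>u\<in>bit_strings k. P t x u * Q t y (bxor u (f x y))) \<ge> 1 - \<epsilon>"
proof -
  let ?U = "bit_strings k"
  obtain \<mu>A \<mu>B :: "coins pmf" and OA OB where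
    O: "\<And>t r x. OA t r x \<in> ?U" "\<And>t r y. OB t r y \<in> ?U"
    and pr: "\<And>x y. measure_pmf.prob (pair_pmf \<mu>A \<mu>B)
                 {(r, s). bxor (OA (transcript \<pi> (r, x) (s, y)) r x)
                         (OB (transcript \<pi> (r, x) (s, y)) s y) = f x y} \<ge> 1 - \<epsilon>"
    using assms(2) unfolding xor_computes_priv_def by blast
  define T where "T = {transcript \<pi> a b | a b. True}"
  \<comment> \<open>Bob's view is quantified away, so the event depends on \<open>x\<close> but not
    on \<open>y\<close>.\<close>
  define SA where "SA t x u = {r. (\<exists>b. transcript \<pi> (r, x) b = t) \<and> OA t r x = u}" for t x u
  define SB where "SB t y v = {s. (\<exists>a. transcript \<pi> a (s, y) = t) \<and> OB t s y = v}" for t y v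
  define P where "P t x u = measure_pmf.prob \<mu>A (SA t x u)" for t x u
  define Q where "Q t y v = measure_pmf.prob \<mu>B (SB t y v)" for t y v
  define h where "h x y = (\<lambda>(r, s). let t = transcript \<pi> (r, x) (s, y) in (t, OA t r x, OB t s y))" for x y
  define D where "D x y = map_pmf (h x y) (pair_pmf \<mu>A \<mu>B)" for x y
  have fin: "finite T" "finite ?U"
    unfolding T_def by (rule finite_transcripts finite_bit_strings)+
  have pmfD: "pmf (D x y) (t, u, v) = P t x u * Q t y v" for x y t u v
  proof -
    have rect: "(\<exists>b. transcript \<pi> (r, x) b = t) \<and> (\<exists>a. transcript \<pi> a (s, y) = t)
        \<longleftrightarrow> transcript \<pi> (r, x) (s, y) = t" for r s
      by (blast intro: transcript_rectangle)
    have "(r, s) \<in> SA t x u \<times> SB t y v \<longleftrightarrow> h x y (r, s) = (t, u, v)" for r s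
      unfolding SA_def SB_def h_def Let_def prod.case prod.inject mem_Sigma_iff mem_Collect_eq
      using rect[of r s] by metis
    then have "h x y -` {(t, u, v)} = SA t x u \<times> SB t y v" by auto
    then show ?thesis
      by (simp add: D_def pmf_map P_def Q_def measure_pmf_prob_product)
  qed
  have setD: "set_pmf (D x y) \<subseteq> T \<times> ?U \<times> ?U" for x y
    by (auto simp: D_def h_def Let_def T_def O)
  have sumD: "(\<Sum>t\<in>T. \<Sum>u\<in>?U. \<Sum>v\<in>?U. P t x u * Q t y v) = 1" for x y
  proof -
    have "(\<Sum>t\<in>T. \<Sum>u\<in>?U. \<Sum>v\<in>?U. P t x u * Q t y v) = (\<Sum>p\<in>T \<times> ?U \<times> ?U. pmf (D x y) p)"
      by (simp add: sum.cartesian_product' pmfD)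
    also have "\<dots> = 1" using fin setD by (intro sum_pmf_eq_1) auto
    finally show ?thesis .
  qed
  have corr: "(\<Sum>t\<in>T. \<Sum>u\<in>?U. P t x u * Q t y (bxor u (f x y))) \<ge> 1 - \<epsilon>" for x y
  proof -
    let ?z = "f x y"
    let ?j = "\<lambda>(t, u). (t, u, bxor u ?z)"
    have "measure_pmf.prob (pair_pmf \<mu>A \<mu>B)
                 {(r, s). bxor (OA (transcript \<pi> (r, x) (s, y)) r x)
                         (OB (transcript \<pi> (r, x) (s, y)) s y) = ?z}
        = measure_pmf.prob (D x y) {(t, u, v). bxor u v = ?z}"
      by (simp add: D_def h_def Let_def vimage_def case_prod_unfold)
    \<comment> \<open>Restriction to a finite set containing the support turns the probability into
      a sum; there \<open>v\<close> is determined by \<open>u\<close>.\<close>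
    also have "\<dots> = measure_pmf.prob (D x y) ({(t, u, v). bxor u v = ?z} \<inter> (T \<times> ?U \<times> ?U))"
      using setD by (intro measure_pmf.finite_measure_eq_AE) (auto simp: AE_measure_pmf_iff)
    also have "{(t, u, v). bxor u v = ?z} \<inter> (T \<times> ?U \<times> ?U) = ?j ` (T \<times> ?U)"
    proof (rule Set.set_eqI)
      fix p :: "bool list \<times> bool list \<times> bool list"
      obtain t u v where p: "p = (t, u, v)" by (cases p)
      show "p \<in> {(t, u, v). bxor u v = ?z} \<inter> (T \<times> ?U \<times> ?U) \<longleftrightarrow> p \<in> ?j ` (T \<times> ?U)"
      proof
        assume "p \<in> {(t, u, v). bxor u v = ?z} \<inter> (T \<times> ?U \<times> ?U)"
        then have "t \<in> T" "u \<in> ?U" "v \<in> ?U" "bxor u v = ?z" by (auto simp: p)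
        moreover from this have "p = ?j (t, u)" using bxor_cancel_left[of u k v] by (simp add: p)
        ultimately show "p \<in> ?j ` (T \<times> ?U)" by blast
      next
        assume "p \<in> ?j ` (T \<times> ?U)"
        then show "p \<in> {(t, u, v). bxor u v = ?z} \<inter> (T \<times> ?U \<times> ?U)"
          using bxor_cancel_left[OF _ f[of x y]] bxor_in_bit_strings[OF _ f[of x y]] by (auto simp: p)
      qed
    qed
    also have "measure_pmf.prob (D x y) (?j ` (T \<times> ?U)) = (\<Sum>p\<in>?j ` (T \<times> ?U). pmf (D x y) p)"
      using fin by (intro measure_measure_pmf_finite) auto
    also have "\<dots> = (\<Sum>(t, u)\<in>T \<times> ?U. P t x u * Q t y (bxor u ?z))"
      by (subst sum.reindex) (auto simp: inj_on_def pmfD intro!: sum.cong)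
    also have "\<dots> = (\<Sum>t\<in>T. \<Sum>u\<in>?U. P t x u * Q t y (bxor u ?z))"
      by (simp add: sum.cartesian_product)
    finally show ?thesis using pr[of x y] by simp
  qed
  \<comment> \<open>For fixed \<open>t\<close>, different outputs come from disjoint sets of
    coins.\<close>
  have "(\<Sum>u\<in>?U. P t x u) \<le> 1" for t x
    unfolding P_def
    by (subst measure_pmf.finite_measure_finite_Union[symmetric])
       (auto simp: fin disjoint_family_on_def SA_def)
  moreover have "(\<Sum>v\<in>?U. Q t y v) \<le> 1" for t y
    unfolding Q_def
    by (subst measure_pmf.finite_measure_finite_Union[symmetric])
       (auto simp: fin disjoint_family_on_def SB_def)
  moreover have "card T \<le> 2 ^ cost \<pi>" unfolding T_def by (rule card_transcripts_le)
  moreover have "P t x u \<ge> 0" "Q t y v \<ge> 0" for t x y u v by (simp_all add: P_def Q_def)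
  ultimately show ?thesis using that fin(1) sumD corr by blast
qed

section \<open>Derandomization by rounding\<close>

text \<open>Bob's message takes \<open>R\<close> bits for each of at most \<open>2 ^ R\<close>
  transcripts; the remaining summands bound the logarithm of the number of tables Alice may
  send.\<close>

lemma D_xor_le:
  fixes f :: "'x \<Rightarrow> 'y \<Rightarrow> bool list"
  assumes \<epsilon>: "\<epsilon> < 1/2"
    and f: "\<And>x y. f x y \<in> bit_strings k"
    and "xor_computes_priv k \<epsilon> f \<pi>"
  defines "R \<equiv> cost \<pi>"
  shows "D_xor k f \<le> enat (R * 2 ^ R + ((k + 1) * nat \<lfloor>2 * 2 ^ R / (1/2 - \<epsilon>)\<rfloor> + 2 ^ R))"
proof -
  let ?U = "bit_strings k"
  obtain T :: "bool list set" and P Q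
    where T: "finite T" and cT: "card T \<le> 2 ^ R"
    and P0: "\<And>t x u. P t x u \<ge> 0" and Q0: "\<And>t y v. Q t y v \<ge> 0"
    and P1: "\<And>t x. (\<Sum>u\<in>?U. P t x u) \<le> 1" and Q1: "\<And>t y. (\<Sum>v\<in>?U. Q t y v) \<le> 1"
    and PQ: "\<And>x y. (\<Sum>t\<in>T. \<Sum>u\<in>?U. \<Sum>v\<in>?U. P t x u * Q t y v) = 1"
    and corr: "\<And>x y. (\<Sum>t\<in>T. \<Sum>u\<in>?U. P t x u * Q t y (bxor u (f x y))) \<ge> 1 - \<epsilon>"
    using xor_priv_product_form[OF f assms(3)] unfolding R_def by blast
  have finU: "finite ?U" by (rule finite_bit_strings)
  define \<delta> where "\<delta> = 1/2 - \<epsilon>"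
  have \<delta>: "\<delta> > 0" using \<epsilon> by (simp add: \<delta>_def)
  define c where "c = \<delta> / 2 ^ R"
  have c: "c > 0" using \<delta> by (simp add: c_def)
  define K where "K = nat \<lfloor>2 * 2 ^ R / \<delta>\<rfloor>"
  define \<beta> where "\<beta> t y = (\<Sum>v\<in>?U. Q t y v)" for t y
  have \<beta>01: "0 \<le> \<beta> t y" "\<beta> t y \<le> 1" for t y using Q0 Q1 by (auto simp: \<beta>_def intro: sum_nonneg)
  \<comment> \<open>Zero is excluded because \<open>bh\<close> occurs as a divisor, and the
    remaining \<open>2 ^ R\<close> values fit exactly into \<open>R\<close> bits.\<close>
  define B where "B = (T \<rightarrow>\<^sub>E {1..2 ^ R :: nat})"
  define mB where "mB y = restrict (\<lambda>t. max 1 (nat \<lceil>\<beta> t y * 2 ^ R\<rceil>)) T" for y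
  define bh where "bh b t = real (b t) / 2 ^ R" for b :: "bool list \<Rightarrow> nat" and t
  define F where "F = {w \<in> extensional (T \<times> ?U). sum w (T \<times> ?U) \<le> K}"
  define w where "w b x = restrict (\<lambda>(t, u). nat \<lfloor>P t x u * bh b t / c\<rfloor>) (T \<times> ?U)" for b x
  \<comment> \<open>For a \<open>b\<close> that no \<open>y\<close> produces, the counts may leave
    \<open>F\<close>; the zero table keeps every reply encodable.\<close>
  define mA where "mA b x = (if w b x \<in> F then w b x else restrict (\<lambda>_. 0) (T \<times> ?U))" for b x
  \<comment> \<open>Estimate of the probability that the outputs XOR to \<open>z\<close>, with
    \<open>P\<close> replaced by the rounded value that Bob recovers from the counts and
    \<open>b\<close>.\<close>
  define E where "E b w y z = (\<Sum>t\<in>T. \<Sum>u\<in>?U. real (w (t, u)) * (c / bh b t) * Q t y (bxor u z))"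
    for b and w :: "bool list \<times> bool list \<Rightarrow> nat" and y z
  define g where "g b w y = (SOME z. z \<in> ?U \<and> E b w y z \<ge> 1/2)" for b w y

  have mB_bounds: "mB y t \<ge> 1" "\<beta> t y \<le> bh (mB y) t" "bh (mB y) t \<le> \<beta> t y + 1 / 2 ^ R" "mB y t \<le> 2 ^ R"
    if "t \<in> T" for y t
  proof -
    let ?q = "\<beta> t y * 2 ^ R"
    have q: "0 \<le> ?q" "?q \<le> 2 ^ R" using \<beta>01[of t y] by auto
    have m: "mB y t = max 1 (nat \<lceil>?q\<rceil>)" using that by (simp add: mB_def)
    show "mB y t \<ge> 1" by (simp add: m)
    have "?q \<le> real (mB y t)" unfolding m by linarith
    then show "\<beta> t y \<le> bh (mB y) t" by (simp add: bh_def field_simps)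
    have "real (mB y t) \<le> ?q + 1" unfolding m using q(1) by linarith
    then show "bh (mB y) t \<le> \<beta> t y + 1 / 2 ^ R" by (simp add: bh_def field_simps)
    have "\<lceil>?q\<rceil> \<le> 2 ^ R" using q(2) by (simp add: ceiling_le_iff)
    then show "mB y t \<le> 2 ^ R" by (simp add: m nat_le_iff)
  qed
  have bh_pos: "bh (mB y) t > 0" if "t \<in> T" for y t
    using mB_bounds(1)[OF that, of y] by (simp add: bh_def)
  have mB: "mB y \<in> B" for y
    using mB_bounds by (auto simp: B_def mB_def)

  have w_F: "w (mB y) x \<in> F" for x y
  proof -
    have "real (sum (w (mB y) x) (T \<times> ?U)) = (\<Sum>t\<in>T. \<Sum>u\<in>?U. real (nat \<lfloor>P t x u * bh (mB y) t / c\<rfloor>))"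
      by (simp add: w_def sum.cartesian_product case_prod_unfold)
    also have "\<dots> \<le> (\<Sum>t\<in>T. \<Sum>u\<in>?U. P t x u * bh (mB y) t / c)"
      using P0 c bh_pos by (intro sum_mono of_nat_floor) (auto simp: less_imp_le)
    \<comment> \<open>The part with \<open>\<beta>\<close> sums to the total probability 1, and the
      excess \<open>1 / 2 ^ R\<close> adds at most 1 over at most \<open>2 ^ R\<close> transcripts.
      Hence the factor 2 in \<open>K\<close>.\<close>
    also have "\<dots> \<le> (\<Sum>t\<in>T. \<Sum>u\<in>?U. P t x u * (\<beta> t y + 1 / 2 ^ R) / c)"
      using P0 c mB_bounds(3) by (intro sum_mono divide_right_mono mult_left_mono) auto
    also have "\<dots> = ((\<Sum>t\<in>T. \<Sum>u\<in>?U. \<Sum>v\<in>?U. P t x u * Q t y v)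
        + (\<Sum>t\<in>T. \<Sum>u\<in>?U. P t x u) / 2 ^ R) / c"
    proof -
      have "P t x u * (\<beta> t y + 1 / 2 ^ R) / c = ((\<Sum>v\<in>?U. P t x u * Q t y v) + P t x u / 2 ^ R) / c" for t u
        by (simp add: \<beta>_def distrib_left sum_distrib_left)
      then show ?thesis by (simp only: sum.distrib sum_divide_distrib[symmetric])
    qed
    also have "\<dots> \<le> (1 + real (2 ^ R) / 2 ^ R) / c"
    proof -
      have "(\<Sum>t\<in>T. \<Sum>u\<in>?U. P t x u) \<le> (\<Sum>t\<in>T. 1)" by (intro sum_mono P1)
      also have "\<dots> \<le> real (2 ^ R)" using cT unfolding of_nat_le_iff[symmetric, where 'a = real] by simp
      finally show ?thesis
        unfolding PQ using c by (intro divide_right_mono add_left_mono) auto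
    qed
    also have "\<dots> = 2 * 2 ^ R / \<delta>" using \<delta> by (simp add: c_def)
    finally have "sum (w (mB y) x) (T \<times> ?U) \<le> K" unfolding K_def by linarith
    then show ?thesis by (simp add: F_def w_def)
  qed
  have mA_eq: "mA (mB y) x = w (mB y) x" for x y by (simp add: mA_def w_F)
  have mA: "mA b x \<in> F" for b x by (auto simp: mA_def F_def)

  have g: "g (mB y) (mA (mB y) x) y = f x y" for x y
  proof -
    define S where "S z = (\<Sum>t\<in>T. \<Sum>u\<in>?U. P t x u * Q t y (bxor u z))" for z
    have trunc: "real (w (mB y) x (t, u)) * (c / bh (mB y) t) \<le> P t x u"
      "P t x u - c / bh (mB y) t \<le> real (w (mB y) x (t, u)) * (c / bh (mB y) t)"
      if "t \<in> T" "u \<in> ?U" for t u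
    proof -
      define a where "a = bh (mB y) t / c"
      have a: "a > 0" using bh_pos[OF that(1), of y] c by (simp add: a_def)
      have wt: "w (mB y) x (t, u) = nat \<lfloor>P t x u * a\<rfloor>" using that by (simp add: w_def a_def)
      have "P t x u * a \<ge> 0" using a P0 by simp
      then have "real (w (mB y) x (t, u)) \<le> P t x u * a" "P t x u * a - 1 \<le> real (w (mB y) x (t, u))"
        unfolding wt by linarith+
      then have "real (w (mB y) x (t, u)) / a \<le> P t x u" "P t x u \<le> (real (w (mB y) x (t, u)) + 1) / a"
        using a by (simp_all add: pos_divide_le_eq pos_le_divide_eq)
      moreover have "c / bh (mB y) t = 1 / a" by (simp add: a_def)
      ultimately show "real (w (mB y) x (t, u)) * (c / bh (mB y) t) \<le> P t x u"
        "P t x u - c / bh (mB y) t \<le> real (w (mB y) x (t, u)) * (c / bh (mB y) t)"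
        by (simp_all add: add_divide_distrib)
    qed
    have upper: "E (mB y) (w (mB y) x) y z \<le> S z" for z
      unfolding E_def S_def using trunc(1) Q0 by (intro sum_mono mult_right_mono) auto
    \<comment> \<open>The loss \<open>c / bh (mB y) t\<close> per output \<open>u\<close> is
      weighted by values of \<open>Q\<close> that sum to \<open>\<beta> t y\<close>, so a transcript
      loses at most \<open>c\<close>, however many outputs there are.\<close>
    have lower: "S z - \<delta> \<le> E (mB y) (w (mB y) x) y z" if z: "z \<in> ?U" for z
    proof -
      have "(\<Sum>t\<in>T. \<Sum>u\<in>?U. (c / bh (mB y) t) * Q t y (bxor u z)) = (\<Sum>t\<in>T. (c / bh (mB y) t) * \<beta> t y)"
        unfolding \<beta>_def sum_distrib_left[symmetric] sum.reindex_bij_betw[OF bij_betw_bxor[OF z]] ..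
      also have "\<dots> \<le> (\<Sum>t\<in>T. c)"
        using mB_bounds(2) bh_pos c by (intro sum_mono) (auto simp: field_simps)
      also have "\<dots> \<le> real (2 ^ R) * c"
        using cT c unfolding sum_constant by (intro mult_right_mono of_nat_mono) auto
      also have "\<dots> = \<delta>" by (simp add: c_def)
      finally have "S z - \<delta> \<le> S z - (\<Sum>t\<in>T. \<Sum>u\<in>?U. (c / bh (mB y) t) * Q t y (bxor u z))" by simp
      also have "\<dots> = (\<Sum>t\<in>T. \<Sum>u\<in>?U. (P t x u - c / bh (mB y) t) * Q t y (bxor u z))"
        by (simp add: S_def left_diff_distrib flip: sum_subtractf)
      also have "\<dots> \<le> E (mB y) (w (mB y) x) y z"
        unfolding E_def using trunc(2) Q0 by (intro sum_mono mult_right_mono) auto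
      finally show ?thesis .
    qed
    \<comment> \<open>For fixed \<open>t\<close> and \<open>u\<close>, distinct targets require
      distinct outputs of Bob, so the two events are disjoint.\<close>
    have Sle: "S z + S (f x y) \<le> 1" if z: "z \<in> ?U" "z \<noteq> f x y" for z
    proof -
      have "P t x u * Q t y (bxor u z) + P t x u * Q t y (bxor u (f x y)) \<le> (\<Sum>v\<in>?U. P t x u * Q t y v)"
        if u: "u \<in> ?U" for t u
      proof -
        have "bxor u z \<noteq> bxor u (f x y)" using bxor_cancel_left u z f by metis
        then have "P t x u * Q t y (bxor u z) + P t x u * Q t y (bxor u (f x y))
          = (\<Sum>v\<in>{bxor u z, bxor u (f x y)}. P t x u * Q t y v)" by simp
        also have "\<dots> \<le> (\<Sum>v\<in>?U. P t x u * Q t y v)"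
          using finU P0 Q0 u z f by (intro sum_mono2) (auto simp: bxor_in_bit_strings)
        finally show ?thesis .
      qed
      then have "S z + S (f x y) \<le> (\<Sum>t\<in>T. \<Sum>u\<in>?U. \<Sum>v\<in>?U. P t x u * Q t y v)"
        unfolding S_def sum.distrib[symmetric] by (intro sum_mono) auto
      then show ?thesis using PQ by simp
    qed
    have good: "S (f x y) \<ge> 1 - \<epsilon>" unfolding S_def by (rule corr)
    show ?thesis
      unfolding mA_eq g_def
    \<comment> \<open>The correct value has estimate at least
      \<open>1 - \<epsilon> - \<delta> = 1/2\<close>; any other \<open>z\<close> has estimate at
      most \<open>S z \<le> \<epsilon> < 1/2\<close>.\<close>
    proof (rule some_equality)
      show "f x y \<in> ?U \<and> 1/2 \<le> E (mB y) (w (mB y) x) y (f x y)"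
        using lower[OF f[of x y]] good f[of x y] by (simp add: \<delta>_def)
    next
      fix z assume z: "z \<in> ?U \<and> 1/2 \<le> E (mB y) (w (mB y) x) y z"
      show "z = f x y"
        using z upper[of z] Sle[of z] good \<epsilon> by (rule_tac ccontr) simp
    qed
  qed

  have "card B = (2 ^ R) ^ card T" by (simp add: B_def card_PiE T)
  also have "\<dots> \<le> (2 ^ R) ^ 2 ^ R" by (rule power_increasing[OF cT]) simp
  finally have card_B: "card B \<le> 2 ^ (R * 2 ^ R)" by (simp add: power_mult)
  have finB: "finite B" unfolding B_def using T by (intro finite_PiE) auto
  have finTU: "finite (T \<times> ?U)" using T finU by blast
  have finF: "finite F" unfolding F_def by (rule card_bounded_sum_functions[OF finTU])
  have "card F \<le> (card (T \<times> ?U) + K) choose K"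
    unfolding F_def by (rule card_bounded_sum_functions[OF finTU])
  \<comment> \<open>A table has \<open>card T * 2 ^ k\<close> entries, so
    \<open>binomial_le_power2\<close> applies with \<open>N = card T\<close>: each unit of
    \<open>K\<close> costs \<open>k + 1\<close> bits.\<close>
  also have "\<dots> \<le> 2 ^ ((k + 1) * K + card T)"
    unfolding card_cartesian_product card_bit_strings by (rule binomial_le_power2)
  also have "\<dots> \<le> 2 ^ ((k + 1) * K + 2 ^ R)" using cT by (intro power_increasing) auto
  finally have card_F: "card F \<le> 2 ^ ((k + 1) * K + 2 ^ R)" .
  show ?thesis
    unfolding K_def[unfolded \<delta>_def, symmetric]
    by (rule D_xor_le_two_messages[where mB = mB and mA = mA and g = g, OF f finB card_B mB finF card_F mA g])
qed

section \<open>Comparison with the stated bound\<close>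

theorem mainTheorem3:
  fixes f :: "'x \<Rightarrow> 'y \<Rightarrow> bool list"
    and k R :: nat
    and \<epsilon> M :: real
  assumes "0 < \<epsilon>" and "\<epsilon> < 1/2"
    and "\<And>x y. f x y \<in> bit_strings k"
    and "R_xor_priv k \<epsilon> f = enat R"
    and "M = 16 * (1/2 - \<epsilon>) powi (-2) * 2 ^ R"
  shows "ereal_of_enat (D_xor k f)
           \<le> ereal (2 ^ (R + 1) * (real R + log 2 (8 / (1/2 - \<epsilon>)) + 1)
                     + real k * ((5 - 2 * \<epsilon>) / 4 * M + 1))"
proof -
  define \<delta> where "\<delta> = 1/2 - \<epsilon>"
  have \<delta>: "0 < \<delta>" "\<delta> < 1/2" using assms(1,2) by (auto simp: \<delta>_def)
  have M: "M = 16 * 2 ^ R / \<delta>\<^sup>2"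
    unfolding assms(5) \<delta>_def[symmetric] by (simp add: power_int_minus field_simps)
  have M0: "M \<ge> 0" by (simp add: M)
  have log0: "log 2 (8 / \<delta>) \<ge> 0" using \<delta> by (simp add: field_simps)
  have coeff: "(5 - 2 * \<epsilon>) / 4 \<ge> 1" using assms(2) by simp
  obtain n :: nat where n: "D_xor k f \<le> enat n"
    "real n \<le> 2 ^ (R + 1) * (real R + log 2 (8 / \<delta>) + 1) + real k * M"
  proof (cases "k = 0")
    \<comment> \<open>The estimate \<open>k + 1 \<le> 2 * k\<close> used below fails here, but all
      outputs are empty and no bit has to be sent.\<close>
    case True
    have "xor_computes_det k f Stop"
      unfolding xor_computes_det_def using assms(3) True
      by (intro exI[of _ "\<lambda>_ _. []"]) (auto simp: bit_strings_def bxor_def)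
    then have "D_xor k f \<le> enat (cost (Stop :: ('x, 'y) protocol))"
      unfolding D_xor_def by (intro INF_lower) simp
    also have "cost (Stop :: ('x, 'y) protocol) = 0" by (simp add: cost_def)
    finally show ?thesis using log0 M0 by (intro that[of 0]) auto
  next
    case False
    let ?C = "(\<lambda>\<pi>. enat (cost \<pi>)) ` {\<pi>. xor_computes_priv k \<epsilon> f \<pi>}"
    have "?C \<noteq> {}"
    proof
      assume "?C = {}"
      then have "R_xor_priv k \<epsilon> f = \<infinity>"
        unfolding R_xor_priv_def by (simp only: Inf_empty top_enat_def)
      then show False using assms(4) by simp
    qed
    then obtain m where "m \<in> ?C" by blast
    \<comment> \<open>The order on \<open>enat\<close> is a well-order, so the infimum is attained
      by a protocol of cost \<open>R\<close>.\<close>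
    then have "Inf ?C \<in> ?C" by (rule wellorder_InfI)
    then have "enat R \<in> ?C" using assms(4) unfolding R_xor_priv_def by simp
    then obtain \<pi> where \<pi>: "xor_computes_priv k \<epsilon> f \<pi>" "cost \<pi> = R"
      by auto
    define K where "K = nat \<lfloor>2 * 2 ^ R / \<delta>\<rfloor>"
    have "real K \<le> 2 * 2 ^ R / \<delta>" unfolding K_def using \<delta> by (intro of_nat_floor) simp
    \<comment> \<open>\<open>M / 2\<close> equals \<open>8 * 2 ^ R / \<delta> ^ 2\<close> and
      \<open>\<delta> < 1/2\<close>. The halving pays for \<open>k + 1 \<le> 2 * k\<close>.\<close>
    also have "\<dots> \<le> M / 2" using \<delta> by (simp add: M field_simps power2_eq_square)
    finally have K: "real K \<le> M / 2" .
    have "real ((k + 1) * K) \<le> (2 * real k) * real K"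
      unfolding of_nat_mult using False by (intro mult_right_mono) auto
    also have "\<dots> \<le> (2 * real k) * (M / 2)" using K by (intro mult_left_mono) auto
    finally have kK: "real ((k + 1) * K) \<le> real k * M" by simp
    have "real (R * 2 ^ R + 2 ^ R) = 2 ^ R * (real R + 1)" by (simp add: algebra_simps)
    also have "\<dots> \<le> 2 ^ (R + 1) * (real R + log 2 (8 / \<delta>) + 1)"
      using log0 by (intro mult_mono) auto
    finally have "real (R * 2 ^ R + ((k + 1) * K + 2 ^ R))
        \<le> 2 ^ (R + 1) * (real R + log 2 (8 / \<delta>) + 1) + real k * M"
      using kK unfolding of_nat_add by linarith
    moreover have "D_xor k f \<le> enat (R * 2 ^ R + ((k + 1) * K + 2 ^ R))"
      using D_xor_le[OF assms(2,3) \<pi>(1)] unfolding \<pi>(2) K_def \<delta>_def .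
    ultimately show ?thesis by (intro that)
  qed
  have "M \<le> (5 - 2 * \<epsilon>) / 4 * M + 1" using mult_right_mono[OF coeff M0] by simp
  then have "real k * M \<le> real k * ((5 - 2 * \<epsilon>) / 4 * M + 1)" by (intro mult_left_mono) auto
  with n(2) have "real n \<le> 2 ^ (R + 1) * (real R + log 2 (8 / \<delta>) + 1)
      + real k * ((5 - 2 * \<epsilon>) / 4 * M + 1)" by linarith
  moreover have "ereal_of_enat (D_xor k f) \<le> ereal (real n)"
    using n(1) unfolding ereal_of_enat_simps(1)[symmetric] ereal_of_enat_le_iff .
  ultimately show ?thesis unfolding \<delta>_def ereal_less_eq(3)[symmetric] by (rule order_trans[rotated])
qed

end
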